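(* Let $T$ be a bounded linear operator on a complex Hilbert space. If $T$ is normaloid and there is a positive integer $n$ such that $T^n$ is invertible and $\|T^n\|^{-1}=\|T^{-n}\|$, then $T$ is a multiple of a unitary operator.
   Context: An operator is a bounded linear transformation of a normed space into itself. An operator $T$ is normaloid if its spectral radius equals its norm, $r(T)=\|T\|$; equivalently, $\|T^k\|=\|T\|^k$ for every integer $k\ge 1$. Invertible means having a bounded inverse; $T^n$ is invertible if and only if $T$ is, and $T^{-n}=(T^{-1})^n=(T^n)^{-1}$. A multiple of a unitary operator is an operator of the form $\alpha U$ with $\alpha\in\mathbb{C}$ and $U$ unitary. *)

theory Defs
  imports "HOL-Analysis.Analysis"
begin

text \<open>
  The underlying real Banach space is the one obtained by restriction of scalars (axiom
  \<open>scaleR_scaleC\<close>). The inner product is linear in the first argument; the last axiom states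
  both that it is positive definite and that it induces the norm.
\<close>

class chilbert_space = banach +
  fixes scaleC :: "complex \<Rightarrow> 'a \<Rightarrow> 'a" (infixr "*\<^sub>C" 75)
    and cinner :: "'a \<Rightarrow> 'a \<Rightarrow> complex"
  assumes scaleC_add_right: "a *\<^sub>C (x + y) = a *\<^sub>C x + a *\<^sub>C y"
    and scaleC_add_left: "(a + b) *\<^sub>C x = a *\<^sub>C x + b *\<^sub>C x"
    and scaleC_scaleC: "a *\<^sub>C (b *\<^sub>C x) = (a * b) *\<^sub>C x"
    and scaleR_scaleC: "r *\<^sub>R x = complex_of_real r *\<^sub>C x"
    and cinner_commute: "cinner x y = cnj (cinner y x)"
    and cinner_add_left: "cinner (x + y) z = cinner x z + cinner y z"
    and cinner_scaleC_left: "cinner (a *\<^sub>C x) y = a * cinner x y"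
    and cinner_self: "cinner x x = complex_of_real ((norm x)\<^sup>2)"

instantiation complex :: chilbert_space
begin

definition scaleC_complex :: "complex \<Rightarrow> complex \<Rightarrow> complex"
  where "scaleC_complex a x = a * x"

definition cinner_complex :: "complex \<Rightarrow> complex \<Rightarrow> complex"
  where "cinner_complex x y = x * cnj y"

instance
  by standard
    (auto simp: scaleC_complex_def cinner_complex_def algebra_simps scaleR_conv_of_real
      complex_norm_square simp flip: of_real_power)

end

definition bounded_clinear :: "('a::chilbert_space \<Rightarrow> 'a) \<Rightarrow> bool"
  where "bounded_clinear T \<longleftrightarrow>
    bounded_linear T \<and> (\<forall>a x. T (a *\<^sub>C x) = a *\<^sub>C T x)"

definition boundedly_invertible :: "('a::chilbert_space \<Rightarrow> 'a) \<Rightarrow> bool"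
  where "boundedly_invertible T \<longleftrightarrow>
    bounded_clinear T \<and> bij T \<and> bounded_clinear (inv T)"

definition spectrum :: "('a::chilbert_space \<Rightarrow> 'a) \<Rightarrow> complex set"
  where "spectrum T = {l. \<not> boundedly_invertible (\<lambda>x. l *\<^sub>C x - T x)}"

text \<open>
  Inserting 0 only matters on the zero space, where the spectrum is empty and the spectral
  radius is 0 by convention.
\<close>

definition spectral_radius :: "('a::chilbert_space \<Rightarrow> 'a) \<Rightarrow> real"
  where "spectral_radius T = Sup (insert 0 (norm ` spectrum T))"

definition normaloid :: "('a::chilbert_space \<Rightarrow> 'a) \<Rightarrow> bool"
  where "normaloid T \<longleftrightarrow> bounded_clinear T \<and> spectral_radius T = onorm T"

definition is_cadjoint :: "('a::chilbert_space \<Rightarrow> 'a) \<Rightarrow> ('a \<Rightarrow> 'a) \<Rightarrow> bool"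
  where "is_cadjoint S T \<longleftrightarrow> (\<forall>x y. cinner (T x) y = cinner x (S y))"

text \<open>An adjoint is unique, so this says that \<open>U\<^sup>* U = U U\<^sup>* = I\<close>.\<close>

definition unitary :: "('a::chilbert_space \<Rightarrow> 'a) \<Rightarrow> bool"
  where "unitary U \<longleftrightarrow> bounded_clinear U \<and>
    (\<exists>V. bounded_clinear V \<and> is_cadjoint V U \<and> V \<circ> U = id \<and> U \<circ> V = id)"

definition multiple_of_unitary :: "('a::chilbert_space \<Rightarrow> 'a) \<Rightarrow> bool"
  where "multiple_of_unitary T \<longleftrightarrow> (\<exists>a U. unitary U \<and> T = (\<lambda>x. a *\<^sub>C U x))"

end

theory Submission
  imports Defs
begin

text \<open>
  If $|l|^n > \|T^n\|$, then $l^n - T^n$ is invertible by Banach's fixed point theorem, and so is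
  its factor $l - T$. Hence $r(T)^n \le \|T^n\|$, and for normaloid $T$ with norm $M$ we get
  $\|T^n\| = M^n$. The hypothesis then gives $M^n \|x\| \le \|T^n x\| \le M^{n-1} \|T x\|$, so
  $\|T x\| = M \|x\|$; since $T$ is onto, $T / M$ is a surjective isometry.
\<close>

section \<open>Complex scalars and bounded complex-linear maps\<close>

lemma scaleC_1 [simp]: "1 *\<^sub>C x = (x::'a::chilbert_space)"
  using scaleR_scaleC[of 1 x] by simp

lemma scaleC_0 [simp]: "0 *\<^sub>C x = (0::'a::chilbert_space)"
  using scaleR_scaleC[of 0 x] by simp

lemma scaleC_diff_right: "a *\<^sub>C (x - y) = a *\<^sub>C x - a *\<^sub>C (y::'a::chilbert_space)"
  by (metis scaleC_add_right add_diff_cancel diff_add_cancel)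

text \<open>The class axioms give homogeneity of the norm for real scalars only. The complex case
  comes from expanding the inner product of \<open>a *\<^sub>C x\<close> with itself, where the
  factor \<open>a * cnj a\<close> appears.\<close>

lemma norm_scaleC: "norm (a *\<^sub>C (x::'a::chilbert_space)) = cmod a * norm x"
proof -
  have "cinner (a *\<^sub>C x) (a *\<^sub>C x) = a * (cnj a * cinner x x)"
    by (metis cinner_commute cinner_scaleC_left complex_cnj_mult)
  then have "complex_of_real ((norm (a *\<^sub>C x))\<^sup>2) = complex_of_real ((cmod a * norm x)\<^sup>2)"
    by (simp add: cinner_self power_mult_distrib mult.assoc[symmetric] flip: complex_norm_square)
  then show ?thesis
    by (metis of_real_eq_iff norm_ge_zero mult_nonneg_nonneg power2_eq_imp_eq)
qed

lemma bounded_clinearI: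
  fixes T :: "'a::chilbert_space \<Rightarrow> 'a"
  assumes "\<And>x y. T (x + y) = T x + T y" and "\<And>a x. T (a *\<^sub>C x) = a *\<^sub>C T x"
    and "\<And>x. norm (T x) \<le> norm x * K"
  shows "bounded_clinear T"
  unfolding bounded_clinear_def
  using assms by (auto intro!: bounded_linear_intro simp: scaleR_scaleC)

lemma bounded_clinear_bounded_linear: "bounded_clinear T \<Longrightarrow> bounded_linear T"
  by (simp add: bounded_clinear_def)

lemma bounded_clinear_scaleC: "bounded_clinear T \<Longrightarrow> T (a *\<^sub>C x) = a *\<^sub>C T x"
  by (simp add: bounded_clinear_def)

lemmas bounded_clinear_add = bounded_clinear_bounded_linear[THEN linear_simps(1)]
lemmas bounded_clinear_diff = bounded_clinear_bounded_linear[THEN linear_simps(2)]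

lemma bounded_clinear_scaleC_left:
  "bounded_clinear (\<lambda>x. a *\<^sub>C (x::'a::chilbert_space))"
  by (rule bounded_clinearI[where K = "cmod a"])
    (simp_all add: scaleC_add_right scaleC_scaleC norm_scaleC mult.commute)

lemma bounded_clinear_plus:
  "bounded_clinear S \<Longrightarrow> bounded_clinear T \<Longrightarrow> bounded_clinear (\<lambda>x. S x + T x)"
  by (auto simp: bounded_clinear_def scaleC_add_right intro: bounded_linear_add)

lemma bounded_clinear_minus:
  "bounded_clinear S \<Longrightarrow> bounded_clinear T \<Longrightarrow> bounded_clinear (\<lambda>x. S x - T x)"
  by (auto simp: bounded_clinear_def scaleC_diff_right intro: bounded_linear_sub)

lemma bounded_clinear_compose:
  "bounded_clinear S \<Longrightarrow> bounded_clinear T \<Longrightarrow> bounded_clinear (\<lambda>x. S (T x))"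
  using bounded_linear_compose[of S T] by (simp add: bounded_clinear_def)

lemma bounded_clinear_funpow: "bounded_clinear T \<Longrightarrow> bounded_clinear (T ^^ n)"
proof (induction n)
  case 0
  then show ?case using bounded_clinear_scaleC_left[of 1] by (simp add: id_def)
next
  case (Suc n)
  then show ?case by (simp add: o_def bounded_clinear_compose)
qed

section \<open>Criteria for bounded invertibility\<close>

text \<open>The lower bound does double duty: it makes the kernel trivial and it bounds the inverse
  by \<open>1 / c\<close>, so the open mapping theorem is not invoked.\<close>

lemma boundedly_invertible_if_bounded_below:
  fixes T :: "'a::chilbert_space \<Rightarrow> 'a"
  assumes T: "bounded_clinear T" and "surj T" and "c > 0"
    and below: "\<And>x. c * norm x \<le> norm (T x)"
  shows "boundedly_invertible T"
proof -
  have "inj T"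
  proof (rule injI)
    fix x y assume "T x = T y"
    then have "T (x - y) = 0" by (simp add: bounded_clinear_diff[OF T])
    with below[of "x - y"] have "c * norm (x - y) \<le> 0" by simp
    with \<open>c > 0\<close> show "x = y" by (simp add: mult_le_0_iff)
  qed
  note Tinv = surj_f_inv_f[OF \<open>surj T\<close>] and invT = inv_f_f[OF \<open>inj T\<close>]
  have "bounded_clinear (inv T)"
  proof (rule bounded_clinearI[where K = "1 / c"])
    show "inv T (x + y) = inv T x + inv T y" for x y
      by (metis Tinv invT bounded_clinear_add[OF T])
    show "inv T (a *\<^sub>C x) = a *\<^sub>C inv T x" for a x
      by (metis Tinv invT bounded_clinear_scaleC[OF T])
    show "norm (inv T x) \<le> norm x * (1 / c)" for x
      using below[of "inv T x"] \<open>c > 0\<close> by (simp add: Tinv field_simps)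
  qed
  with T \<open>inj T\<close> \<open>surj T\<close> show ?thesis
    by (simp add: boundedly_invertible_def bij_def)
qed

text \<open>The reverse triangle inequality gives the lower bound; completeness of the space gives
  surjectivity.\<close>

lemma boundedly_invertible_scaleC_minus:
  fixes A :: "'a::chilbert_space \<Rightarrow> 'a"
  assumes A: "bounded_clinear A" and less: "onorm A < cmod c"
  shows "boundedly_invertible (\<lambda>x. c *\<^sub>C x - A x)"
proof (rule boundedly_invertible_if_bounded_below)
  note Ab = bounded_clinear_bounded_linear[OF A]
  show "bounded_clinear (\<lambda>x. c *\<^sub>C x - A x)"
    by (intro bounded_clinear_minus bounded_clinear_scaleC_left A)
  show "0 < cmod c - onorm A" using less by simp
  show "(cmod c - onorm A) * norm x \<le> norm (c *\<^sub>C x - A x)" for x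
    using onorm[OF Ab, of x] norm_triangle_ineq2[of "c *\<^sub>C x" "A x"]
    by (simp add: norm_scaleC algebra_simps)
  have c: "c \<noteq> 0" using less onorm_pos_le[OF Ab] by auto
  show "surj (\<lambda>x. c *\<^sub>C x - A x)"
  proof (unfold surj_def, intro allI)
    fix y
    \<comment> \<open>Solving \<open>c *\<^sub>C x - A x = y\<close> for \<open>x\<close> means
      finding a fixed point of \<open>?f\<close>, which is a contraction with factor
      \<open>onorm A / cmod c < 1\<close>.\<close>
    let ?f = "\<lambda>x. inverse c *\<^sub>C (y + A x)"
    have "\<exists>!x. ?f x = x"
    proof (rule banach_fix_type[where c = "onorm A / cmod c"])
      show "\<forall>x z. dist (?f x) (?f z) \<le> onorm A / cmod c * dist x z"
      proof (intro allI)
        fix x z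
        have "?f x - ?f z = inverse c *\<^sub>C A (x - z)"
          by (simp add: scaleC_diff_right[symmetric] bounded_clinear_diff[OF A])
        then show "dist (?f x) (?f z) \<le> onorm A / cmod c * dist x z"
          using onorm[OF Ab, of "x - z"]
          by (simp add: dist_norm norm_scaleC norm_inverse divide_inverse[symmetric]
              divide_right_mono mult.commute[of "inverse _"])
      qed
    qed (use less c onorm_pos_le[OF Ab] in auto)
    then obtain x where "?f x = x" by blast
    then have "c *\<^sub>C x = c *\<^sub>C ?f x" by simp
    also have "\<dots> = y + A x" using c by (simp add: scaleC_scaleC)
    finally have "y = c *\<^sub>C x - A x" by simp
    then show "\<exists>x. y = c *\<^sub>C x - A x" ..
  qed
qed

section \<open>Spectrum and spectral radius against norms of powers\<close>

text \<open>Here \<open>S\<close> is the sum of \<open>l ^ (n - 1 - k)\<close> times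
  \<open>T ^^ k\<close> over \<open>k < n\<close>, built by recursion. Both orders of composition
  are recorded because \<open>l - T\<close> will need a left and a right inverse.\<close>

lemma scaleC_power_minus_funpow_factor:
  fixes T :: "'a::chilbert_space \<Rightarrow> 'a"
  assumes T: "bounded_clinear T"
  obtains S where "bounded_clinear S"
    and "\<And>x. S (l *\<^sub>C x - T x) = l ^ n *\<^sub>C x - (T ^^ n) x"
    and "\<And>x. l *\<^sub>C S x - T (S x) = l ^ n *\<^sub>C x - (T ^^ n) x"
proof (induction n arbitrary: thesis)
  case 0
  show ?case
  proof (rule 0)
    show "bounded_clinear (\<lambda>x::'a. 0)"
      using bounded_clinear_scaleC_left[of 0] by simp
  qed (use bounded_clinear_diff[OF T, of 0 0] scaleC_diff_right[of l 0 0] in simp_all)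
next
  case (Suc n)
  obtain S where S: "bounded_clinear S"
    and SB: "\<And>x. S (l *\<^sub>C x - T x) = l ^ n *\<^sub>C x - (T ^^ n) x"
    and BS: "\<And>x. l *\<^sub>C S x - T (S x) = l ^ n *\<^sub>C x - (T ^^ n) x"
    using Suc.IH by blast
  \<comment> \<open>This follows the splitting
    \<open>l ^ Suc n - T ^^ Suc n = l ^ n (l - T) + (l ^ n - T ^^ n) T\<close>.\<close>
  let ?S = "\<lambda>x. l ^ n *\<^sub>C x + S (T x)"
  show ?case
  proof (rule Suc.prems)
    show "bounded_clinear ?S"
      by (intro bounded_clinear_plus bounded_clinear_scaleC_left bounded_clinear_compose[OF S T])
    show "?S (l *\<^sub>C x - T x) = l ^ Suc n *\<^sub>C x - (T ^^ Suc n) x" for x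
      using SB[of "T x"]
      by (simp add: bounded_clinear_diff[OF T] bounded_clinear_scaleC[OF T] scaleC_diff_right
          scaleC_scaleC funpow_swap1 mult.commute)
    show "l *\<^sub>C ?S x - T (?S x) = l ^ Suc n *\<^sub>C x - (T ^^ Suc n) x" for x
      using BS[of "T x"]
      by (simp add: bounded_clinear_add[OF T] bounded_clinear_scaleC[OF T] scaleC_add_right
          scaleC_scaleC funpow_swap1 algebra_simps)
  qed
qed

lemma norm_spectrum_power_le:
  assumes T: "bounded_clinear T" and l: "l \<in> spectrum T"
  shows "cmod l ^ n \<le> onorm (T ^^ n)"
proof (rule ccontr)
  assume "\<not> ?thesis"
  then have "onorm (T ^^ n) < cmod (l ^ n)" by (simp add: norm_power)
  define P where "P = (\<lambda>x. l ^ n *\<^sub>C x - (T ^^ n) x)"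
  define B where "B = (\<lambda>x. l *\<^sub>C x - T x)"
  have "boundedly_invertible P"
    unfolding P_def
    by (rule boundedly_invertible_scaleC_minus[OF bounded_clinear_funpow[OF T]]) fact
  then have "bij P" and invP: "bounded_clinear (inv P)"
    by (simp_all add: boundedly_invertible_def)
  obtain S where S: "bounded_clinear S" and SB: "\<And>x. S (B x) = P x" and BS: "\<And>x. B (S x) = P x"
    using scaleC_power_minus_funpow_factor[OF T, of l n] unfolding P_def B_def by metis
  \<comment> \<open>The two factorizations of \<open>P\<close> give \<open>B\<close> a left inverse
    and a right inverse; these must then coincide, so there is no need to commute \<open>S\<close>
    with \<open>inv P\<close> by hand.\<close>
  have left: "(inv P \<circ> S) \<circ> B = id" and right: "B \<circ> (S \<circ> inv P) = id"
    using \<open>bij P\<close> by (simp_all add: fun_eq_iff SB BS bij_is_inj bij_is_surj surj_f_inv_f)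
  then have "inv P \<circ> S = S \<circ> inv P" by (rule left_right_inverse_eq)
  with left right have "bij B" and "inv B = S \<circ> inv P"
    by (auto intro: o_bij inv_unique_comp)
  moreover have "bounded_clinear (S \<circ> inv P)"
    unfolding o_def by (rule bounded_clinear_compose[OF S invP])
  moreover have "bounded_clinear B"
    unfolding B_def by (intro bounded_clinear_minus bounded_clinear_scaleC_left T)
  ultimately have "boundedly_invertible B"
    by (simp add: boundedly_invertible_def)
  with l show False by (simp add: spectrum_def B_def)
qed

lemma spectral_radius_power_le:
  assumes T: "bounded_clinear T" and "n > 0" and "0 \<le> spectral_radius T"
  shows "spectral_radius T ^ n \<le> onorm (T ^^ n)"
proof -
  have pos: "0 \<le> onorm (T ^^ n)"
    using bounded_clinear_funpow[OF T] by (intro onorm_pos_le bounded_clinear_bounded_linear)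
  \<comment> \<open>Taking the root first leaves a bound on the supremum itself, which can be
    checked element by element.\<close>
  have "spectral_radius T \<le> root n (onorm (T ^^ n))"
    unfolding spectral_radius_def
  proof (rule cSup_least)
    fix r assume "r \<in> insert 0 (cmod ` spectrum T)"
    \<comment> \<open>For the inserted 0 the bound rests on \<open>0 ^ n = 0\<close>, hence on
      \<open>n > 0\<close>.\<close>
    then have "0 \<le> r" and "r ^ n \<le> onorm (T ^^ n)"
      using norm_spectrum_power_le[OF T, of _ n] pos \<open>n > 0\<close> by (auto simp: power_0_left)
    then show "r \<le> root n (onorm (T ^^ n))"
      using \<open>n > 0\<close> by (metis real_root_le_mono real_root_power_cancel)
  qed simp
  then show ?thesis
    using assms(2,3) pos by (metis power_mono real_root_pow_pos2)
qed

lemma norm_funpow_le: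
  fixes T :: "'a::real_normed_vector \<Rightarrow> 'a"
  assumes "\<And>x. norm (T x) \<le> M * norm x" and "0 \<le> M"
  shows "norm ((T ^^ n) x) \<le> M ^ n * norm x"
proof (induction n)
  case (Suc n)
  have "norm ((T ^^ Suc n) x) \<le> M * norm ((T ^^ n) x)" using assms(1) by simp
  also have "\<dots> \<le> M * (M ^ n * norm x)" by (intro mult_left_mono Suc assms(2))
  finally show ?case by simp
qed simp

section \<open>Surjective isometries are unitary\<close>

text \<open>Writing the difference as \<open>x + (- 1) *\<^sub>C y\<close> lets additivity and
  complex homogeneity alone carry a linear map through the formula.\<close>

lemma Re_cinner_polarization:
  "4 * Re (cinner x y) = (norm (x + y))\<^sup>2 - (norm (x + (- 1) *\<^sub>C y))\<^sup>2"
proof -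
  have right: "cinner u (v + w) = cinner u v + cinner u w" for u v w :: 'a
    by (metis cinner_commute cinner_add_left complex_cnj_add)
  have scale: "cinner u (a *\<^sub>C v) = cnj a * cinner u v" for u v :: 'a and a
    by (metis cinner_commute cinner_scaleC_left complex_cnj_mult)
  have sq: "(norm u)\<^sup>2 = Re (cinner u u)" for u :: 'a by (simp add: cinner_self)
  have "Re (cinner y x) = Re (cinner x y)" by (subst cinner_commute) simp
  then show ?thesis
    by (simp add: sq right scale cinner_add_left cinner_scaleC_left)
qed

text \<open>Polarization expresses the real part through norms, which \<open>U\<close> preserves.
  Replacing \<open>x\<close> by \<open>\<i> *\<^sub>C x\<close> turns the imaginary part into a real
  part, up to sign.\<close>

lemma isometry_preserves_cinner:
  assumes U: "bounded_clinear U" and iso: "\<And>x. norm (U x) = norm x"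
  shows "cinner (U x) (U y) = cinner x y"
proof -
  have Re: "Re (cinner (U x) (U y)) = Re (cinner x y)" for x y
    using Re_cinner_polarization[of "U x" "U y"] Re_cinner_polarization[of x y]
    by (simp add: bounded_clinear_add[OF U, symmetric] bounded_clinear_scaleC[OF U, symmetric] iso)
  have "Im (cinner x y) = - Re (cinner (\<i> *\<^sub>C x) y)" for x y :: 'a
    by (simp add: cinner_scaleC_left)
  then have "Im (cinner (U x) (U y)) = Im (cinner x y)"
    by (metis Re bounded_clinear_scaleC[OF U])
  with Re show ?thesis by (simp add: complex_eq_iff)
qed

text \<open>The inverse serves as the adjoint: write \<open>y = U (inv U y)\<close> and cancel
  \<open>U\<close> from both arguments of \<open>cinner (U x) y\<close>.\<close>

lemma unitary_surj_isometry:
  assumes U: "bounded_clinear U" and "surj U" and iso: "\<And>x. norm (U x) = norm x"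
  shows "unitary U"
proof -
  have "boundedly_invertible U"
    using boundedly_invertible_if_bounded_below[OF U \<open>surj U\<close>, of 1] iso by simp
  then have "bij U" and "bounded_clinear (inv U)"
    by (simp_all add: boundedly_invertible_def)
  moreover have "is_cadjoint (inv U) U"
    unfolding is_cadjoint_def
    by (metis isometry_preserves_cinner[OF U iso] surj_f_inv_f[OF \<open>surj U\<close>])
  moreover have "inv U \<circ> U = id" "U \<circ> inv U = id"
    using \<open>bij U\<close> by (simp_all add: bij_is_inj surj_iff[symmetric] bij_is_surj)
  ultimately show ?thesis using U unfolding unitary_def by blast
qed

lemma multiple_of_unitary_if_norm_eq:
  fixes T :: "'a::chilbert_space \<Rightarrow> 'a"
  assumes T: "bounded_clinear T" and "surj T" and "M > 0"
    and eq: "\<And>x. norm (T x) = M * norm x"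
  shows "multiple_of_unitary T"
proof -
  let ?U = "\<lambda>x. complex_of_real (inverse M) *\<^sub>C T x"
  have M: "complex_of_real M * complex_of_real (inverse M) = 1"
    using \<open>M > 0\<close> by simp
  have "unitary ?U"
  proof (rule unitary_surj_isometry)
    show "bounded_clinear ?U"
      by (intro bounded_clinear_compose[OF bounded_clinear_scaleC_left T])
    show "surj ?U"
    proof (unfold surj_def, intro allI)
      fix y
      obtain x where "T x = complex_of_real M *\<^sub>C y" using \<open>surj T\<close> by (metis surjD)
      then have "y = ?U x" using M by (simp add: scaleC_scaleC mult.commute)
      then show "\<exists>x. y = ?U x" ..
    qed
    show "norm (?U x) = norm x" for x
      using \<open>M > 0\<close> by (simp add: norm_scaleC eq norm_inverse)
  qed
  moreover have "T = (\<lambda>x. complex_of_real M *\<^sub>C ?U x)"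
    by (simp only: scaleC_scaleC M scaleC_1)
  ultimately show ?thesis unfolding multiple_of_unitary_def by blast
qed

theorem theorem5p2:
  fixes T :: "'a::chilbert_space \<Rightarrow> 'a"
  assumes "bounded_clinear T"
    and "normaloid T"
    and "\<exists>n::nat. n > 0 \<and> boundedly_invertible (T ^^ n) \<and>
      inverse (onorm (T ^^ n)) = onorm (inv (T ^^ n))"
  shows "multiple_of_unitary T"
proof -
  note T = assms(1)
  note Tb = bounded_clinear_bounded_linear[OF T]
  obtain n where "n > 0" and inv: "boundedly_invertible (T ^^ n)"
    and norm_inv: "inverse (onorm (T ^^ n)) = onorm (inv (T ^^ n))"
    using assms(3) by blast
  obtain m where n: "n = Suc m" using \<open>n > 0\<close> by (cases n) auto
  have bij: "bij (T ^^ n)" and invb: "bounded_linear (inv (T ^^ n))"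
    using inv by (simp_all add: boundedly_invertible_def bounded_clinear_def)
  \<comment> \<open>The outermost factor of \<open>T ^^ Suc m\<close> is \<open>T\<close>, so its
    range contains that of the power.\<close>
  have "surj T"
    using bij_is_surj[OF bij] unfolding n by (auto simp: surj_def)
  define M where "M = onorm T"
  have "0 \<le> M" and le: "norm (T x) \<le> M * norm x" for x
    unfolding M_def using onorm_pos_le[OF Tb] onorm[OF Tb] by auto
  have pow_le: "M ^ n \<le> onorm (T ^^ n)"
    using spectral_radius_power_le[OF T \<open>n > 0\<close>] assms(2) \<open>0 \<le> M\<close>
    by (simp add: normaloid_def M_def)
  show ?thesis
  proof (cases "M = 0")
    \<comment> \<open>A zero operator that is onto forces the space to be trivial. Every norm
      identity then holds, and the constant 1 is chosen because a positive one is required.\<close>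
    case True
    then have "T x = 0" for x using le[of x] by simp
    then have "x = 0" for x :: 'a using \<open>surj T\<close> by (metis surjD)
    then have "norm (T x) = 1 * norm x" for x by (metis mult_1)
    then show ?thesis
      by (rule multiple_of_unitary_if_norm_eq[OF T \<open>surj T\<close> zero_less_one])
  next
    case False
    then have "M > 0" using \<open>0 \<le> M\<close> by simp
    then have pos: "0 < onorm (T ^^ n)" using pow_le by (meson less_le_trans zero_less_power)
    have "norm (T x) = M * norm x" for x
    proof (rule antisym[OF le])
      have "norm x = norm (inv (T ^^ n) ((T ^^ n) x))"
        by (simp add: inv_f_f[OF bij_is_inj[OF bij]])
      \<comment> \<open>The hypothesis on the inverse makes \<open>T ^^ n\<close> stretch every
        vector by at least its own operator norm.\<close>
      also have "\<dots> \<le> inverse (onorm (T ^^ n)) * norm ((T ^^ n) x)"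
        unfolding norm_inv by (rule onorm[OF invb])
      finally have "onorm (T ^^ n) * norm x \<le> norm ((T ^^ n) x)"
        using pos by (simp add: field_simps)
      then have "M ^ n * norm x \<le> norm ((T ^^ n) x)"
        using pow_le by (meson mult_right_mono norm_ge_zero order_trans)
      \<comment> \<open>Only the innermost \<open>T\<close> is kept exact; the other
        \<open>m\<close> factors are estimated by \<open>M ^ m\<close>, which cancels against
        \<open>M ^ n\<close> to leave a single \<open>M\<close>.\<close>
      also have "\<dots> = norm ((T ^^ m) (T x))"
        by (simp add: n funpow_swap1)
      also have "\<dots> \<le> M ^ m * norm (T x)"
        by (rule norm_funpow_le[OF le \<open>0 \<le> M\<close>])
      finally show "M * norm x \<le> norm (T x)"
        using \<open>M > 0\<close> by (simp add: n mult.assoc mult.left_commute)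
    qed
    then show ?thesis
      by (rule multiple_of_unitary_if_norm_eq[OF T \<open>surj T\<close> \<open>M > 0\<close>])
  qed
qed

end
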